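(* Let $L\in\mathbb{R}^{n\times n}$ be irreducible with zero column sums, spectral abscissa $0$ with $0$ a simple eigenvalue, and eventually exponentially positive. Then there exists $\gamma_0\in[0,\infty)$ such that $\mathcal I-\gamma L$ is invertible and $$(\mathcal I-\gamma L)^{-1}>0\qquad\text{for all }\gamma\ge\gamma_0,\ \gamma>0 .$$ Moreover, if $L$ has at least one negative off-diagonal entry, then there exists $\gamma_1>0$ such that $(\mathcal I-\gamma L)^{-1}$ has a negative entry for all $\gamma\in(0,\gamma_1)$; in particular every $\gamma_0\in[0,\infty)$ such that $\mathcal I-\gamma L$ is invertible with $(\mathcal I-\gamma L)^{-1}>0$ for all $\gamma\ge\gamma_0$, $\gamma>0$, satisfies $\gamma_0>0$. If instead $L$ is Metzler, then one may take $\gamma_0=0$, i.e. $(\mathcal I-\gamma L)^{-1}>0$ for all $\gamma>0$.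
   Context: $\mathcal I$ is the $n\times n$ identity matrix. Matrix inequalities are entrywise: $M>0$ means every entry of $M$ is strictly positive. The spectral abscissa is the maximal real part of the eigenvalues. $L$ is eventually exponentially positive if there is $\tau_0\ge0$ such that $e^{tL}>0$ for all $t\ge\tau_0$. $L$ is Metzler if all its off-diagonal entries are nonnegative. *)

theory Defs
  imports "Jordan_Normal_Form.Spectral_Radius" "Jordan_Normal_Form.Gauss_Jordan_Elimination"
begin

(* Not the library order on matrices: there 0 < M only means 0 \<le> M and M \<noteq> 0. *)
definition pos_mat :: "real mat \<Rightarrow> bool" where
  "pos_mat A \<longleftrightarrow> (\<forall>i<dim_row A. \<forall>j<dim_col A. 0 < A $$ (i, j))"

definition metzler_mat :: "real mat \<Rightarrow> bool" where
  "metzler_mat A \<longleftrightarrow> (\<forall>i<dim_row A. \<forall>j<dim_col A. i \<noteq> j \<longrightarrow> 0 \<le> A $$ (i, j))"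

(* Some simultaneous permutation of rows and columns brings A to block upper triangular
   form with two nonempty square diagonal blocks, of sizes r and dim_row A - r.
   In particular every 1 x 1 matrix is irreducible. *)
definition reducible_mat :: "'a :: zero mat \<Rightarrow> bool" where
  "reducible_mat A \<longleftrightarrow>
     (\<exists>p r. p permutes {..<dim_row A} \<and> 0 < r \<and> r < dim_row A \<and>
            (\<forall>i\<in>{r..<dim_row A}. \<forall>j<r. A $$ (p i, p j) = 0))"

definition irreducible_mat :: "'a :: zero mat \<Rightarrow> bool" where
  "irreducible_mat A \<longleftrightarrow> \<not> reducible_mat A"

(* The maximum runs over the complex eigenvalues; it is only meaningful for nonempty
   square matrices, where the spectrum is finite and nonempty. *)
definition spectral_abscissa :: "real mat \<Rightarrow> real" where
  "spectral_abscissa A = Max (Re ` spectrum (map_mat complex_of_real A))"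

definition simple_eigenvalue :: "'a :: field mat \<Rightarrow> 'a \<Rightarrow> bool" where
  "simple_eigenvalue A k \<longleftrightarrow> eigenvalue A k \<and> Polynomial.order k (char_poly A) = 1"

(* The exponential series, summed entrywise; see summable_mat_exp for convergence. *)
definition mat_exp :: "real mat \<Rightarrow> real mat" where
  "mat_exp A = mat (dim_row A) (dim_col A) (\<lambda>ij. \<Sum>k. (A ^\<^sub>m k) $$ ij / fact k)"

lemma summable_mat_exp:
  fixes A :: "real mat"
  assumes A: "A \<in> carrier_mat n n" and ij: "i < n" "j < n"
  shows "summable (\<lambda>k. (A ^\<^sub>m k) $$ (i, j) / fact k)"
proof -
  define c where "c = (\<Sum>i<n. \<Sum>j<n. \<bar>A $$ (i, j)\<bar>)"
  have c0: "0 \<le> c" unfolding c_def by (intro sum_nonneg) auto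
  have c: "\<bar>A $$ (i, j)\<bar> \<le> c" if "i < n" "j < n" for i j
  proof -
    have "\<bar>A $$ (i, j)\<bar> \<le> (\<Sum>j<n. \<bar>A $$ (i, j)\<bar>)"
      using that by (intro member_le_sum) auto
    also have "\<dots> \<le> c"
      unfolding c_def using that
      by (intro member_le_sum[where f = "\<lambda>i. \<Sum>j<n. \<bar>A $$ (i, j)\<bar>"] sum_nonneg) auto
    finally show ?thesis .
  qed
  have bnd: "\<bar>(A ^\<^sub>m k) $$ (i, j)\<bar> \<le> (real n * c) ^ k" if "i < n" "j < n" for i j k
    using that
  proof (induction k arbitrary: j)
    case 0
    then show ?case using A by auto
  next
    case (Suc k)
    have "(A ^\<^sub>m Suc k) $$ (i, j) = (\<Sum>l<n. (A ^\<^sub>m k) $$ (i, l) * A $$ (l, j))"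
      using A Suc.prems pow_carrier_mat[OF A, of k]
      by (auto simp: scalar_prod_def atLeast0LessThan intro!: sum.cong)
    also have "\<bar>\<dots>\<bar> \<le> (\<Sum>l<n. \<bar>(A ^\<^sub>m k) $$ (i, l)\<bar> * \<bar>A $$ (l, j)\<bar>)"
      unfolding abs_mult[symmetric] by (rule sum_abs)
    also have "\<dots> \<le> (\<Sum>l<n. (real n * c) ^ k * c)"
      using Suc c c0 by (intro sum_mono mult_mono) auto
    finally show ?case by (simp add: algebra_simps)
  qed
  have "summable (\<lambda>k. (real n * c) ^ k / fact k)"
    using summable_exp[of "real n * c"] by (simp add: field_simps)
  then show ?thesis
    by (rule summable_comparison_test') (use bnd ij in \<open>auto simp: divide_right_mono\<close>)
qed

definition eventually_exp_positive :: "real mat \<Rightarrow> bool" where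
  "eventually_exp_positive A \<longleftrightarrow> (\<exists>\<tau>\<ge>0. \<forall>t\<ge>\<tau>. pos_mat (mat_exp (t \<cdot>\<^sub>m A)))"

definition inv_mat :: "'a :: field mat \<Rightarrow> 'a mat" where
  "inv_mat A = the (mat_inverse A)"

lemma inv_mat:
  assumes "invertible_mat A"
  shows "inverts_mat A (inv_mat A)" and "inverts_mat (inv_mat A) A"
proof -
  define n where "n = dim_row A"
  from assms have A: "A \<in> carrier_mat n n"
    unfolding invertible_mat_def n_def by auto
  from assms obtain B where AB: "A * B = 1\<^sub>m n" and BA: "B * A = 1\<^sub>m (dim_row B)"
    unfolding invertible_mat_def inverts_mat_def n_def by auto
  have B: "B \<in> carrier_mat n n"
    using arg_cong[OF AB, of dim_col] arg_cong[OF BA, of dim_col] A by auto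
  have "A \<in> Units (ring_mat TYPE('a) n ())"
    unfolding Units_def ring_mat_def using A B AB BA by auto
  then obtain C where C: "mat_inverse A = Some C"
    using mat_inverse(1)[OF A, where b = "()"] by (cases "mat_inverse A") auto
  with mat_inverse(2)[OF A C] A
  show "inverts_mat A (inv_mat A)" "inverts_mat (inv_mat A) A"
    unfolding inv_mat_def inverts_mat_def by auto
qed

end

theory Submission
  imports Defs
begin

text \<open>
  Write the characteristic polynomial as \<open>s q(s)\<close>; simplicity of \<open>0\<close> and the spectral abscissa give
  \<open>q > 0\<close> on \<open>[0, \<infinity>)\<close>, and \<open>(s I - L)\<^sup>-\<^sup>1 = adj(s I - L) / (s q(s))\<close> with \<open>s = 1 / \<gamma>\<close>. Every
  column of \<open>adj(- L)\<close> lies in the kernel of \<open>L\<close>, and since \<open>s I - L\<close> has column sums \<open>s\<close> the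
  column sums of \<open>adj(s I - L)\<close> are \<open>q(s)\<close>. A kernel vector with positive sum is fixed by the positive
  column-stochastic matrix \<open>exp(t L)\<close>, hence positive. So \<open>adj(- L) > 0\<close>, and by continuity
  \<open>adj(s I - L) > 0\<close> for small \<open>s\<close>, that is, for large \<open>\<gamma>\<close>.
\<close>

section \<open>Adjugates of polynomial matrices\<close>

lemma mult_mat_index_sum:
  assumes "A \<in> carrier_mat n m" "B \<in> carrier_mat m l" "i < n" "j < l"
  shows "(A * B) $$ (i, j) = (\<Sum>k<m. A $$ (i, k) * B $$ (k, j))"
  using assms by (auto simp: scalar_prod_def atLeast0LessThan intro!: sum.cong)

text \<open>\<open>inv_mat\<close> is read off from Gauss-Jordan elimination, so explicit formulas
  for it go through uniqueness: over a field a right inverse is two-sided, and then it agrees with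
  \<open>inv_mat A\<close>.\<close>

lemma invertible_mat_right_inverse:
  fixes A :: "'a :: field mat"
  assumes A: "A \<in> carrier_mat n n" and B: "B \<in> carrier_mat n n" and AB: "A * B = 1\<^sub>m n"
  shows "invertible_mat A" and "inv_mat A = B"
proof -
  have BA: "B * A = 1\<^sub>m n" by (rule mat_mult_left_right_inverse[OF A B AB])
  show inv: "invertible_mat A"
    unfolding invertible_mat_def inverts_mat_def using A B AB BA by auto
  let ?C = "inv_mat A"
  have AC: "A * ?C = 1\<^sub>m n" and CA: "?C * A = 1\<^sub>m (dim_row ?C)"
    using inv_mat[OF inv] A unfolding inverts_mat_def by auto
  have C: "?C \<in> carrier_mat n n"
    using arg_cong[OF AC, of dim_col] arg_cong[OF CA, of dim_col] A by auto
  have "?C = ?C * (A * B)" using C AB by simp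
  also have "\<dots> = (?C * A) * B" using A B C by simp
  also have "\<dots> = B" using CA C B by simp
  finally show "?C = B" .
qed

lemma inv_mat_entries:
  fixes A :: "'a :: field mat"
  assumes A: "A \<in> carrier_mat n n"
    and f: "\<And>i j. i < n \<Longrightarrow> j < n \<Longrightarrow> (\<Sum>k<n. A $$ (i, k) * f k j) = (if i = j then 1 else 0)"
  shows "invertible_mat A" and "inv_mat A = mat n n (\<lambda>(i, j). f i j)"
proof -
  have "A * mat n n (\<lambda>(i, j). f i j) = 1\<^sub>m n"
  proof (rule eq_matI)
    fix i j assume "i < dim_row (1\<^sub>m n :: 'a mat)" "j < dim_col (1\<^sub>m n :: 'a mat)"
    then have ij: "i < n" "j < n" by auto
    have "(A * mat n n (\<lambda>(i, j). f i j)) $$ (i, j)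
        = (\<Sum>k<n. A $$ (i, k) * mat n n (\<lambda>(i, j). f i j) $$ (k, j))"
      by (rule mult_mat_index_sum) (use A ij in auto)
    also have "\<dots> = (\<Sum>k<n. A $$ (i, k) * f k j)" using ij by (intro sum.cong) auto
    finally show "(A * mat n n (\<lambda>(i, j). f i j)) $$ (i, j) = 1\<^sub>m n $$ (i, j)"
      using f[OF ij] ij by auto
  qed (use A in auto)
  from invertible_mat_right_inverse[OF A _ this]
  show "invertible_mat A" and "inv_mat A = mat n n (\<lambda>(i, j). f i j)" by auto
qed

lemma adj_mat_entries:
  fixes Q :: "'a :: comm_ring_1 mat"
  assumes Q: "Q \<in> carrier_mat n n" and ij: "i < n" "j < n"
  shows "(\<Sum>k<n. Q $$ (i, k) * adj_mat Q $$ (k, j)) = (if i = j then det Q else 0)"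
    and "(\<Sum>k<n. adj_mat Q $$ (i, k) * Q $$ (k, j)) = (if i = j then det Q else 0)"
proof -
  note adj = adj_mat[OF Q]
  show "(\<Sum>k<n. Q $$ (i, k) * adj_mat Q $$ (k, j)) = (if i = j then det Q else 0)"
    by (simp add: mult_mat_index_sum[OF Q adj(1) ij, symmetric] adj(2) ij)
  show "(\<Sum>k<n. adj_mat Q $$ (i, k) * Q $$ (k, j)) = (if i = j then det Q else 0)"
    by (simp add: mult_mat_index_sum[OF adj(1) Q ij, symmetric] adj(3) ij)
qed

text \<open>Evaluation at \<open>x\<close> is a ring homomorphism. Taking the adjugate over the
  polynomial ring makes its entries continuous in \<open>x\<close>, also where the determinant
  vanishes.\<close>

lemma adj_mat_entries_poly:
  fixes Q :: "'a :: comm_ring_1 poly mat"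
  assumes "Q \<in> carrier_mat n n" and "i < n" "j < n"
  shows "(\<Sum>k<n. poly (Q $$ (i, k)) x * poly (adj_mat Q $$ (k, j)) x)
      = (if i = j then poly (det Q) x else 0)"
    and "(\<Sum>k<n. poly (adj_mat Q $$ (i, k)) x * poly (Q $$ (k, j)) x)
      = (if i = j then poly (det Q) x else 0)"
  using arg_cong[OF adj_mat_entries(1)[OF assms], of "\<lambda>p. poly p x"]
    arg_cong[OF adj_mat_entries(2)[OF assms], of "\<lambda>p. poly p x"]
  by (auto simp: poly_sum split: if_splits)

lemma char_poly_matrix_index:
  assumes "A \<in> carrier_mat n n" "i < n" "j < n"
  shows "char_poly_matrix A $$ (i, j) = (if i = j then [:- A $$ (i, j), 1:] else [:- A $$ (i, j):])"
  using assms unfolding char_poly_matrix_def by auto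

text \<open>With s = 1 / \<gamma> the matrix is \<gamma> (s I - L), and s I - L is inverted by its
  adjugate divided by its determinant, the characteristic polynomial at s.\<close>

lemma resolvent_adj_char_poly_matrix:
  fixes L :: "'a :: field mat"
  assumes L: "L \<in> carrier_mat n n" and g: "\<gamma> \<noteq> 0" and p: "poly (char_poly L) (1 / \<gamma>) \<noteq> 0"
  shows "invertible_mat (1\<^sub>m n - \<gamma> \<cdot>\<^sub>m L)"
    and "inv_mat (1\<^sub>m n - \<gamma> \<cdot>\<^sub>m L) = mat n n (\<lambda>(i, j).
      poly (adj_mat (char_poly_matrix L) $$ (i, j)) (1 / \<gamma>) / (\<gamma> * poly (char_poly L) (1 / \<gamma>)))"
proof -
  let ?Q = "char_poly_matrix L" and ?s = "1 / \<gamma>"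
  have "(\<Sum>k<n. (1\<^sub>m n - \<gamma> \<cdot>\<^sub>m L) $$ (i, k) *
      (poly (adj_mat ?Q $$ (k, j)) ?s / (\<gamma> * poly (char_poly L) ?s))) = (if i = j then 1 else 0)"
    (is "?lhs = _") if ij: "i < n" "j < n" for i j
  proof -
    have "?lhs = (\<Sum>k<n. poly (?Q $$ (i, k)) ?s * poly (adj_mat ?Q $$ (k, j)) ?s)
        / poly (char_poly L) ?s"
      unfolding sum_divide_distrib
      by (intro sum.cong refl) (use ij L g p in \<open>auto simp: char_poly_matrix_index field_simps\<close>)
    also have "\<dots> = (if i = j then 1 else 0)"
      using adj_mat_entries_poly(1)[OF char_poly_matrix_closed[OF L] ij, of ?s] p
      by (simp add: char_poly_def)
    finally show ?thesis .
  qed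
  from inv_mat_entries[OF minus_carrier_mat[OF smult_carrier_mat[OF L]] this]
  show "invertible_mat (1\<^sub>m n - \<gamma> \<cdot>\<^sub>m L)"
    and "inv_mat (1\<^sub>m n - \<gamma> \<cdot>\<^sub>m L) = mat n n (\<lambda>(i, j).
      poly (adj_mat ?Q $$ (i, j)) ?s / (\<gamma> * poly (char_poly L) ?s))" by auto
qed

section \<open>The spectral abscissa and the characteristic polynomial\<close>

text \<open>A real root is also an eigenvalue of the complexified matrix and equals its own real
  part, so it takes part in the maximum over the finite spectrum.\<close>

lemma root_char_poly_le_spectral_abscissa:
  fixes L :: "real mat"
  assumes L: "L \<in> carrier_mat n n" and s: "poly (char_poly L) s = 0"
  shows "s \<le> spectral_abscissa L"
proof -
  let ?L = "map_mat complex_of_real L"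
  have cL: "?L \<in> carrier_mat n n" using L by simp
  have "poly (char_poly ?L) (complex_of_real s) = 0"
    using s by (simp add: of_real_hom.char_poly_hom[OF L])
  then have "complex_of_real s \<in> spectrum ?L" by (simp add: spectrum_root_char_poly[OF cL])
  then have "s \<in> Re ` spectrum ?L" by force
  then show ?thesis unfolding spectral_abscissa_def
    using card_finite_spectrum(1)[OF cL] by simp
qed

text \<open>The cofactor \<open>q\<close> has no zero at 0, where the root is simple, and none at s
  > 0, where a root would exceed the spectral abscissa. Being monic, it is positive far to the
  right, hence on the whole half-line by the intermediate value theorem.\<close>

lemma char_poly_simple_zero:
  fixes L :: "real mat"
  assumes L: "L \<in> carrier_mat n n" and abscissa: "spectral_abscissa L = 0"
    and simple: "simple_eigenvalue L 0"
  obtains q where "char_poly L = [:0, 1:] * q" and "\<And>s. 0 \<le> s \<Longrightarrow> 0 < poly q s"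
proof -
  let ?p = "char_poly L"
  have lc: "lead_coeff ?p = 1" using degree_monic_char_poly[OF L] by simp
  then have "?p \<noteq> 0" by auto
  from order_decomp[OF this, of 0] simple obtain q
    where q: "?p = [:0, 1:] * q" and ndvd: "\<not> [:0, 1:] dvd q"
    by (auto simp: simple_eigenvalue_def)
  have nz: "poly q s \<noteq> 0" if "0 \<le> s" for s
  proof (cases "s = 0")
    case True
    then show ?thesis using ndvd poly_eq_0_iff_dvd[of q 0] by simp
  next
    case False
    then show ?thesis
      using root_char_poly_le_spectral_abscissa[OF L, of s] that abscissa by (auto simp: q)
  qed
  have "lead_coeff q = 1" using lc unfolding q lead_coeff_mult by simp
  with poly_pinfty_gt_lc[of q] obtain x where x: "\<And>y. x \<le> y \<Longrightarrow> 0 < poly q y" by force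
  have "0 < poly q s" if "0 \<le> s" for s
  proof (rule ccontr)
    assume "\<not> 0 < poly q s"
    with nz[OF that] have "poly q s < 0" by auto
    \<comment> \<open>The point \<open>max x (s + 1)\<close> lies strictly to the right of
      \<open>s\<close> and in the region where \<open>q\<close> is known to be positive; a zero in
      between contradicts \<open>nz\<close>.\<close>
    with poly_IVT_pos[of s "max x (s + 1)" q] x[of "max x (s + 1)"] nz that show False by force
  qed
  with q that show ?thesis by blast
qed

text \<open>Multiply (X I - L) adj(X I - L) = det(X I - L) I from the left by the all-ones row,
  which X I - L scales by X. Cancelling X among polynomials makes the result valid at s = 0 too,
  where division by s would fail.\<close>

lemma adj_char_poly_matrix_col_sum:
  fixes L :: "'a :: idom mat"
  assumes L: "L \<in> carrier_mat n n" and colsum: "\<forall>j<n. (\<Sum>i<n. L $$ (i, j)) = 0"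
    and q: "char_poly L = [:0, 1:] * q" and j: "j < n"
  shows "(\<Sum>i<n. adj_mat (char_poly_matrix L) $$ (i, j)) = q"
proof -
  let ?Q = "char_poly_matrix L" and ?C = "adj_mat (char_poly_matrix L)"
  have col: "(\<Sum>i<n. ?Q $$ (i, k)) = [:0, 1:]" if k: "k < n" for k
  proof -
    have "(\<Sum>i<n. ?Q $$ (i, k)) = (\<Sum>i<n. (if i = k then [:0, 1:] else 0) - [:L $$ (i, k):])"
      using k L by (intro sum.cong) (auto simp: char_poly_matrix_index)
    also have "\<dots> = [:0, 1:] - [:\<Sum>i<n. L $$ (i, k):]"
      using k by (simp add: sum_subtractf sum_to_poly)
    finally show ?thesis using colsum k by simp
  qed
  have "char_poly L = (\<Sum>i<n. if i = j then char_poly L else 0)" using j by simp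
  also have "\<dots> = (\<Sum>i<n. \<Sum>k<n. ?Q $$ (i, k) * ?C $$ (k, j))"
    using adj_mat_entries(1)[OF char_poly_matrix_closed[OF L] _ j]
    by (intro sum.cong) (auto simp: char_poly_def)
  also have "\<dots> = (\<Sum>k<n. (\<Sum>i<n. ?Q $$ (i, k)) * ?C $$ (k, j))"
    unfolding sum_distrib_right by (rule sum.swap)
  also have "\<dots> = [:0, 1:] * (\<Sum>k<n. ?C $$ (k, j))"
    unfolding sum_distrib_left using col by (intro sum.cong) auto
  finally have "[:0, 1:] * q = [:0, 1:] * (\<Sum>k<n. ?C $$ (k, j))" unfolding q .
  then show ?thesis by (metis mult_left_cancel pCons_eq_0_iff zero_neq_one)
qed

section \<open>The exponential of a matrix with zero column sums\<close>

lemma sums_mat_exp: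
  assumes A: "A \<in> carrier_mat n n" and ij: "i < n" "j < n"
  shows "(\<lambda>k. (A ^\<^sub>m k) $$ (i, j) / fact k) sums (mat_exp A $$ (i, j))"
  using summable_sums[OF summable_mat_exp[OF assms]] A ij by (simp add: mat_exp_def)

lemma sums_only_zeroth:
  fixes f :: "nat \<Rightarrow> real"
  assumes "\<And>k. k > 0 \<Longrightarrow> f k = 0"
  shows "f sums f 0"
  using sums_finite[of "{0}" f] assms by simp

text \<open>The all-ones row annihilates A, hence every positive power of A, so only the identity
  term of the exponential series contributes to a column sum.\<close>

lemma mat_exp_col_sum:
  assumes A: "A \<in> carrier_mat n n" and colsum: "\<forall>j<n. (\<Sum>i<n. A $$ (i, j)) = 0" and j: "j < n"
  shows "(\<Sum>i<n. mat_exp A $$ (i, j)) = 1"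
proof -
  have col: "(\<Sum>i<n. (A ^\<^sub>m k) $$ (i, j)) = (if k = 0 then 1 else 0)" if "j < n" for j k
    using that
  proof (induction k arbitrary: j)
    case 0
    have "(\<Sum>i<n. (A ^\<^sub>m 0) $$ (i, j)) = (\<Sum>i<n. if i = j then 1 else 0)"
      using A 0 by (intro sum.cong) auto
    then show ?case using 0 by simp
  next
    case (Suc k)
    have "(\<Sum>i<n. (A ^\<^sub>m Suc k) $$ (i, j)) = (\<Sum>i<n. \<Sum>l<n. (A ^\<^sub>m k) $$ (i, l) * A $$ (l, j))"
      using mult_mat_index_sum[OF pow_carrier_mat[OF A] A _ Suc.prems] by (intro sum.cong) auto
    also have "\<dots> = (\<Sum>l<n. (\<Sum>i<n. (A ^\<^sub>m k) $$ (i, l)) * A $$ (l, j))"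
      unfolding sum_distrib_right by (rule sum.swap)
    also have "\<dots> = (if k = 0 then 1 else 0) * (\<Sum>l<n. A $$ (l, j))"
      unfolding sum_distrib_left using Suc.IH by (intro sum.cong) auto
    finally show ?case using colsum Suc.prems by simp
  qed
  have "(\<lambda>k. \<Sum>i<n. (A ^\<^sub>m k) $$ (i, j) / fact k) sums (\<Sum>i<n. mat_exp A $$ (i, j))"
    by (intro sums_sum sums_mat_exp[OF A]) (use j in auto)
  moreover have "(\<lambda>k. \<Sum>i<n. (A ^\<^sub>m k) $$ (i, j) / fact k) sums 1"
    using sums_only_zeroth[of "\<lambda>k. \<Sum>i<n. (A ^\<^sub>m k) $$ (i, j) / fact k"] col[OF j]
    by (simp add: sum_divide_distrib[symmetric] del: pow_mat.simps)
  ultimately show ?thesis by (rule sums_unique2)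
qed

text \<open>Dually, A v = 0 gives A^(m+1) v = A^m (A v) = 0, and only the identity term of the
  series acts on v.\<close>

lemma mat_exp_kernel:
  assumes A: "A \<in> carrier_mat n n" and ker: "\<And>i. i < n \<Longrightarrow> (\<Sum>j<n. A $$ (i, j) * v j) = 0"
    and i: "i < n"
  shows "(\<Sum>j<n. mat_exp A $$ (i, j) * v j) = v i"
proof -
  let ?f = "\<lambda>k. \<Sum>j<n. (A ^\<^sub>m k) $$ (i, j) / fact k * v j"
  have "?f k = 0" if "k > 0" for k
  proof -
    from that obtain m where k: "k = Suc m" by (cases k) auto
    have "(\<Sum>j<n. (A ^\<^sub>m k) $$ (i, j) * v j)
        = (\<Sum>j<n. \<Sum>l<n. (A ^\<^sub>m m) $$ (i, l) * (A $$ (l, j) * v j))"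
      unfolding k using mult_mat_index_sum[OF pow_carrier_mat[OF A] A i]
      by (intro sum.cong) (auto simp: sum_distrib_right mult.assoc)
    also have "\<dots> = (\<Sum>l<n. (A ^\<^sub>m m) $$ (i, l) * (\<Sum>j<n. A $$ (l, j) * v j))"
      unfolding sum_distrib_left by (rule sum.swap)
    also have "\<dots> = 0" using ker by simp
    finally show ?thesis by (simp add: sum_divide_distrib[symmetric])
  qed
  then have "?f sums ?f 0" by (rule sums_only_zeroth)
  moreover have "?f 0 = (\<Sum>j<n. if j = i then v j else 0)"
    using A i by (intro sum.cong) auto
  moreover have "?f sums (\<Sum>j<n. mat_exp A $$ (i, j) * v j)"
    by (intro sums_sum sums_mult2 sums_mat_exp[OF A]) (use i in auto)
  ultimately show ?thesis using i by (auto dest: sums_unique2)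
qed

text \<open>A positive column-stochastic matrix does not increase the \<open>l\<^sup>1\<close> norm, so a fixed vector
  attains equality in every triangle inequality and therefore has constant sign.\<close>

lemma stochastic_fixed_vector_pos:
  fixes P :: "nat \<Rightarrow> nat \<Rightarrow> real"
  assumes P: "\<And>i j. i < n \<Longrightarrow> j < n \<Longrightarrow> 0 < P i j"
    and col: "\<And>j. j < n \<Longrightarrow> (\<Sum>i<n. P i j) = 1"
    and fixed: "\<And>i. i < n \<Longrightarrow> (\<Sum>j<n. P i j * v j) = v i"
    and sum: "0 < (\<Sum>j<n. v j)" and i: "i < n"
  shows "0 < v i"
proof -
  have le: "\<bar>v i\<bar> \<le> (\<Sum>j<n. P i j * \<bar>v j\<bar>)" if "i < n" for i
  proof -
    have "\<bar>v i\<bar> = \<bar>\<Sum>j<n. P i j * v j\<bar>" using fixed that by simp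
    also have "\<dots> \<le> (\<Sum>j<n. \<bar>P i j * v j\<bar>)" by (rule sum_abs)
    also have "\<dots> = (\<Sum>j<n. P i j * \<bar>v j\<bar>)"
      by (intro sum.cong) (use P that in \<open>auto simp: abs_mult less_imp_le\<close>)
    finally show ?thesis .
  qed
  have "(\<Sum>i<n. \<Sum>j<n. P i j * \<bar>v j\<bar>) = (\<Sum>j<n. (\<Sum>i<n. P i j) * \<bar>v j\<bar>)"
    unfolding sum_distrib_right by (rule sum.swap)
  then have "(\<Sum>i<n. (\<Sum>j<n. P i j * \<bar>v j\<bar>) - \<bar>v i\<bar>) = 0" using col by (simp add: sum_subtractf)
  then have eq: "(\<Sum>j<n. P i j * \<bar>v j\<bar>) = \<bar>v i\<bar>" if "i < n" for i
    using le that by (subst (asm) sum_nonneg_eq_0_iff) auto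
  obtain m where m: "m < n" "0 < v m"
    using sum sum_nonpos[of "{..<n}" v] by (meson lessThan_iff not_le)
  \<comment> \<open>Row \<open>m\<close>, where the fixed vector is positive, has equal sums with
    and without absolute values. All weights \<open>P m j\<close> are positive, so no entry can be
    negative.\<close>
  have "(\<Sum>j<n. P m j * (\<bar>v j\<bar> - v j)) = 0"
    using eq[OF m(1)] fixed[OF m(1)] m(2) by (simp add: right_diff_distrib sum_subtractf)
  then have "P m j * (\<bar>v j\<bar> - v j) = 0" if "j < n" for j
    using P[OF m(1)] that by (subst (asm) sum_nonneg_eq_0_iff) (auto simp: less_imp_le)
  then have nonneg: "0 \<le> v j" if "j < n" for j using P[OF m(1)] that by force
  \<comment> \<open>Strictness comes from the single term at \<open>m\<close>, since
    \<open>P i m\<close> and \<open>v m\<close> are both positive.\<close>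
  have "0 < (\<Sum>j<n. P i j * v j)"
    by (rule sum_pos2[of _ m]) (use m P[OF i] nonneg in \<open>auto simp: less_imp_le\<close>)
  then show ?thesis using fixed i by simp
qed

text \<open>One time t with exp(t L) > 0 suffices: t L inherits the zero column sums and the kernel
  vector, so exp(t L) is a positive column-stochastic matrix fixing v.\<close>

lemma kernel_vector_pos:
  assumes L: "L \<in> carrier_mat n n" and colsum: "\<forall>j<n. (\<Sum>i<n. L $$ (i, j)) = 0"
    and evpos: "eventually_exp_positive L"
    and ker: "\<And>i. i < n \<Longrightarrow> (\<Sum>j<n. L $$ (i, j) * v j) = 0"
    and sum: "0 < (\<Sum>j<n. v j)" and i: "i < n"
  shows "0 < v i"
proof -
  obtain t where pos: "pos_mat (mat_exp (t \<cdot>\<^sub>m L))"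
    using evpos unfolding eventually_exp_positive_def by blast
  let ?S = "t \<cdot>\<^sub>m L"
  have S: "?S \<in> carrier_mat n n" using L by simp
  have "\<forall>j<n. (\<Sum>i<n. ?S $$ (i, j)) = 0"
    using L colsum by (simp add: sum_distrib_left[symmetric])
  moreover have "(\<Sum>j<n. ?S $$ (i, j) * v j) = 0" if "i < n" for i
  proof -
    have "(\<Sum>j<n. ?S $$ (i, j) * v j) = t * (\<Sum>j<n. L $$ (i, j) * v j)"
      unfolding sum_distrib_left by (intro sum.cong) (use L that in auto)
    then show ?thesis using ker[OF that] by simp
  qed
  ultimately show ?thesis
    using stochastic_fixed_vector_pos[of n "\<lambda>i j. mat_exp ?S $$ (i, j)" v i]
      mat_exp_col_sum[OF S] mat_exp_kernel[OF S, of v] pos sum i L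
    by (simp add: pos_mat_def mat_exp_def)
qed

section \<open>Large and small values of the parameter\<close>

lemma resolvent_pos_large:
  assumes L: "L \<in> carrier_mat n n" and colsum: "\<forall>j<n. (\<Sum>i<n. L $$ (i, j)) = 0"
    and evpos: "eventually_exp_positive L"
    and q: "char_poly L = [:0, 1:] * q" and qpos: "\<And>s. 0 \<le> s \<Longrightarrow> 0 < poly q s"
  shows "\<exists>\<gamma>\<^sub>0>0. \<forall>\<gamma>\<ge>\<gamma>\<^sub>0. pos_mat (inv_mat (1\<^sub>m n - \<gamma> \<cdot>\<^sub>m L))"
proof -
  let ?Q = "char_poly_matrix L"
  let ?C = "adj_mat ?Q"
  have Q: "?Q \<in> carrier_mat n n" using L by simp
  have C0: "0 < poly (?C $$ (i, j)) 0" if ij: "i < n" "j < n" for i j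
  proof (rule kernel_vector_pos[OF L colsum evpos, of "\<lambda>k. poly (?C $$ (k, j)) 0"])
    show "(\<Sum>k<n. L $$ (l, k) * poly (?C $$ (k, j)) 0) = 0" if l: "l < n" for l
    proof -
      have "(\<Sum>k<n. L $$ (l, k) * poly (?C $$ (k, j)) 0)
          = - (\<Sum>k<n. poly (?Q $$ (l, k)) 0 * poly (?C $$ (k, j)) 0)"
        unfolding sum_negf[symmetric]
        by (intro sum.cong) (use L l in \<open>auto simp: char_poly_matrix_index\<close>)
      also have "\<dots> = 0"
        using adj_mat_entries_poly(1)[OF Q l ij(2), of 0] by (simp add: char_poly_def[symmetric] q)
      finally show ?thesis .
    qed
    show "0 < (\<Sum>k<n. poly (?C $$ (k, j)) 0)"
      using adj_char_poly_matrix_col_sum[OF L colsum q ij(2)] qpos[of 0]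
      by (simp add: poly_sum[symmetric])
  qed (use ij in auto)
  \<comment> \<open>Finitely many entries are involved, so positivity at 0 spreads to all of them on
    one common right neighbourhood.\<close>
  have "eventually (\<lambda>s. \<forall>i\<in>{..<n}. \<forall>j\<in>{..<n}. 0 < poly (?C $$ (i, j)) s) (at_right 0)"
  proof (intro eventually_ball_finite ballI finite_lessThan)
    fix i j assume "i \<in> {..<n}" "j \<in> {..<n}"
    then show "eventually (\<lambda>s. 0 < poly (?C $$ (i, j)) s) (at_right 0)"
      using C0[of i j] by (intro order_tendstoD(1)[where y = "poly (?C $$ (i, j)) 0"])
        (auto intro!: tendsto_intros)
  qed
  then obtain b where b: "0 < b" "\<And>s i j. 0 < s \<Longrightarrow> s < b \<Longrightarrow> i < n \<Longrightarrow> j < n \<Longrightarrow> 0 < poly (?C $$ (i, j)) s"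
    unfolding eventually_at_right_field by auto
  \<comment> \<open>The bound 2 / b keeps 1 / \<gamma> at most b / 2, strictly inside the interval
    where the adjugate is positive.\<close>
  have "pos_mat (inv_mat (1\<^sub>m n - \<gamma> \<cdot>\<^sub>m L))" if "2 / b \<le> \<gamma>" for \<gamma>
  proof -
    have g: "0 < \<gamma>" using b(1) that by (meson divide_pos_pos less_le_trans zero_less_numeral)
    have s: "1 / \<gamma> < b" using b(1) that g by (simp add: field_simps)
    have p: "0 < poly (char_poly L) (1 / \<gamma>)" using g qpos[of "1 / \<gamma>"] by (simp add: q)
    show ?thesis
      unfolding pos_mat_def resolvent_adj_char_poly_matrix(2)[OF L
          less_imp_neq[OF g, symmetric] less_imp_neq[OF p, symmetric]]
      using b(2)[of "1 / \<gamma>"] g s p by auto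
  qed
  then show ?thesis using b(1) by (intro exI[of _ "2 / b"]) auto
qed

text \<open>To first order in \<open>\<gamma>\<close> the resolvent is \<open>I + \<gamma> L\<close>; the error is controlled by
  writing its entries as quotients of polynomials in \<open>\<gamma>\<close>.\<close>

lemma resolvent_neg_small:
  fixes L :: "real mat"
  assumes L: "L \<in> carrier_mat n n" and ij: "i < n" "j < n" "i \<noteq> j" and neg: "L $$ (i, j) < 0"
  shows "\<exists>\<gamma>\<^sub>1>0. \<forall>\<gamma>. 0 < \<gamma> \<and> \<gamma> < \<gamma>\<^sub>1 \<longrightarrow>
    invertible_mat (1\<^sub>m n - \<gamma> \<cdot>\<^sub>m L) \<and> inv_mat (1\<^sub>m n - \<gamma> \<cdot>\<^sub>m L) $$ (i, j) < 0"
proof -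
  \<comment> \<open>Here the parameter itself is the polynomial variable: \<open>Q\<close> is I - X
    L. Small \<gamma> is then a neighbourhood of 0, whereas the characteristic matrix would need s =
    1 / \<gamma> tending to infinity.\<close>
  define Q where "Q = mat n n (\<lambda>(i, j). [:if i = j then 1 else 0, - L $$ (i, j):])"
  have Q: "Q \<in> carrier_mat n n" by (simp add: Q_def)
  have Qe: "poly (Q $$ (i, j)) x = (1\<^sub>m n - x \<cdot>\<^sub>m L) $$ (i, j)" if "i < n" "j < n" for i j x
    using that L by (simp add: Q_def)
  let ?A = "\<lambda>i j x. poly (adj_mat Q $$ (i, j)) x" and ?d = "poly (det Q)"
  \<comment> \<open>\<open>g x\<close> is the entry (i, j) of adj(I - x L) L. Off the diagonal,
    adj(Q) Q = det(Q) I turns the adjugate entry into x g(x), so its sign for small x > 0 is that of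
    g(0) = L_ij.\<close>
  define g where "g x = (\<Sum>k<n. ?A i k x * L $$ (k, j))" for x
  \<comment> \<open>\<open>Q\<close> evaluates to the identity at 0, so adj(Q) Q = det(Q) I gives
    the adjugate there directly.\<close>
  have A0: "?A i k 0 = (if i = k then ?d 0 else 0)" if k: "k < n" for k
  proof -
    have "?A i k 0 = (\<Sum>l<n. if l = k then ?A i l 0 else 0)" using k by simp
    also have "\<dots> = (\<Sum>l<n. ?A i l 0 * poly (Q $$ (l, k)) 0)"
      using k by (intro sum.cong) (auto simp: Q_def)
    finally show ?thesis using adj_mat_entries_poly(2)[OF Q ij(1) k, of 0] by simp
  qed
  have "map_mat (\<lambda>p. poly p 0) Q = 1\<^sub>m n"
    by (rule eq_matI) (auto simp: Q_def)
  then have d0: "?d 0 = 1"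
    using comm_ring_hom.hom_det[OF poly_hom.comm_ring_hom_axioms, of 0 Q] by simp
  have "g 0 = (\<Sum>k<n. if k = i then L $$ (k, j) else 0)"
    unfolding g_def using A0 d0 by (intro sum.cong) auto
  then have g0: "g 0 < 0" using ij neg by simp
  have Ag: "?A i j x = x * g x" for x
  proof -
    have "0 = (\<Sum>k<n. ?A i k x * poly (Q $$ (k, j)) x)"
      using adj_mat_entries_poly(2)[OF Q ij(1,2), of x] ij(3) by simp
    also have "\<dots> = (\<Sum>k<n. (if k = j then ?A i k x else 0) - x * (?A i k x * L $$ (k, j)))"
      using ij by (intro sum.cong) (auto simp: Q_def algebra_simps)
    also have "\<dots> = ?A i j x - x * g x"
      using ij by (simp add: sum_subtractf g_def sum_distrib_left)
    finally show ?thesis by simp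
  qed
  have "eventually (\<lambda>x. 0 < ?d x) (at_right 0)"
    by (rule order_tendstoD(1)[OF tendsto_poly[OF tendsto_ident_at]]) (simp add: d0)
  moreover have "eventually (\<lambda>x. g x < 0) (at_right 0)"
    using g0 unfolding g_def
    by (intro order_tendstoD(2)[where y = "\<Sum>k<n. ?A i k 0 * L $$ (k, j)"])
      (auto intro!: tendsto_intros)
  ultimately have "eventually (\<lambda>x. 0 < ?d x \<and> g x < 0) (at_right 0)" by (rule eventually_conj)
  then obtain b where b: "0 < b" "\<And>x. 0 < x \<Longrightarrow> x < b \<Longrightarrow> 0 < ?d x" "\<And>x. 0 < x \<Longrightarrow> x < b \<Longrightarrow> g x < 0"
    unfolding eventually_at_right_field by auto
  have "invertible_mat (1\<^sub>m n - x \<cdot>\<^sub>m L) \<and> inv_mat (1\<^sub>m n - x \<cdot>\<^sub>m L) $$ (i, j) < 0"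
    if x: "0 < x" "x < b" for x
  proof -
    have "(\<Sum>k<n. (1\<^sub>m n - x \<cdot>\<^sub>m L) $$ (i, k) * (?A k j x / ?d x)) = (if i = j then 1 else 0)"
      if ij: "i < n" "j < n" for i j
    proof -
      have "(\<Sum>k<n. (1\<^sub>m n - x \<cdot>\<^sub>m L) $$ (i, k) * (?A k j x / ?d x))
          = (\<Sum>k<n. poly (Q $$ (i, k)) x * ?A k j x) / ?d x"
        unfolding sum_divide_distrib by (intro sum.cong refl) (use Qe ij in auto)
      then show ?thesis using adj_mat_entries_poly(1)[OF Q ij, of x] b(2)[OF x] by simp
    qed
    note inv = inv_mat_entries[OF minus_carrier_mat[OF smult_carrier_mat[OF L]] this]
    have "?A i j x / ?d x < 0"
      unfolding Ag using x b(2,3)[OF x] by (simp add: divide_neg_pos mult_pos_neg)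
    then show ?thesis using inv ij by simp
  qed
  then show ?thesis using b(1) by blast
qed

section \<open>Metzler matrices\<close>

text \<open>Listing the complement of \<open>Z\<close> first and \<open>Z\<close> last puts the rows
  in \<open>Z\<close> and the columns outside \<open>Z\<close> into the lower left block, which
  vanishes.\<close>

lemma reducible_matI:
  assumes A: "A \<in> carrier_mat n n" and Z: "Z \<subseteq> {..<n}" "Z \<noteq> {}" "Z \<noteq> {..<n}"
    and zero: "\<And>i j. i \<in> Z \<Longrightarrow> j < n \<Longrightarrow> j \<notin> Z \<Longrightarrow> A $$ (i, j) = 0"
  shows "reducible_mat A"
proof -
  define W where "W = {..<n} - Z"
  define r where "r = card W"
  have fin: "finite Z" "finite W" using Z(1) finite_subset by (auto simp: W_def)
  have card: "card Z = n - r" "r \<le> n"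
    using card_Diff_subset[OF fin(1) Z(1)] card_mono[OF _ Z(1)] by (auto simp: r_def W_def)
  have "W \<noteq> {}" using Z by (auto simp: W_def)
  then have r: "0 < r" "r < n"
    using fin card Z(2) card_gt_0_iff[of Z] card_gt_0_iff[of W] by (auto simp: r_def)
  obtain f where f: "bij_betw f {..<r} W"
    using bij_betw_iff_card[of "{..<r}" W] fin by (auto simp: r_def)
  obtain g where g: "bij_betw g {r..<n} Z"
    using bij_betw_iff_card[of "{r..<n}" Z] fin card by auto
  \<comment> \<open>Fixing every index from \<open>n\<close> on makes the glued bijection a
    permutation in the sense of \<open>permutes\<close>.\<close>
  define p where "p i = (if i < r then f i else if i < n then g i else i)" for i
  have pf: "bij_betw p {..<r} W" using f by (subst bij_betw_cong[of _ _ f]) (auto simp: p_def)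
  have pg: "bij_betw p {r..<n} Z" using g by (subst bij_betw_cong[of _ _ g]) (auto simp: p_def)
  have "bij_betw p ({..<r} \<union> {r..<n}) (W \<union> Z)"
    by (rule bij_betw_combine[OF pf pg]) (auto simp: W_def)
  moreover have "{..<r} \<union> {r..<n} = {..<n}" "W \<union> Z = {..<n}" using r Z(1) by (auto simp: W_def)
  ultimately have "p permutes {..<n}"
    using r by (intro bij_imp_permutes) (auto simp: p_def)
  moreover have "A $$ (p i, p j) = 0" if "i \<in> {r..<n}" "j < r" for i j
    using bij_betwE[OF pg] bij_betwE[OF pf] that zero by (auto simp: W_def)
  ultimately show ?thesis unfolding reducible_mat_def
    using A r by (intro exI[of _ p] exI[of _ r]) auto
qed

text \<open>Column dominance of \<open>I - \<gamma> L\<close> gives \<open>\<Sum>\<bar>x\<^sub>i\<bar> \<le> \<Sum>y\<^sub>i = \<Sum>x\<^sub>i\<close>, hence \<open>x \<ge> 0\<close>;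
  the zero set of \<open>x\<close> would then witness reducibility.\<close>

lemma metzler_resolvent_vector_pos:
  fixes L :: "real mat" and x y :: "nat \<Rightarrow> real"
  assumes L: "L \<in> carrier_mat n n" and irred: "irreducible_mat L"
    and colsum: "\<forall>j<n. (\<Sum>i<n. L $$ (i, j)) = 0" and metzler: "metzler_mat L"
    and \<gamma>: "0 < \<gamma>" and y: "\<And>i. i < n \<Longrightarrow> 0 \<le> y i" "0 < (\<Sum>i<n. y i)"
    and eq: "\<And>i. i < n \<Longrightarrow> x i - \<gamma> * (\<Sum>k<n. L $$ (i, k) * x k) = y i" and i: "i < n"
  shows "0 < x i"
proof -
  have off: "0 \<le> L $$ (i, k)" if "i < n" "k < n" "i \<noteq> k" for i k
    using metzler L that by (auto simp: metzler_mat_def)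
  \<comment> \<open>Stated for arbitrary \<open>z\<close> because it is applied both to
    \<open>x\<close> and to the vector of absolute values.\<close>
  have zero: "(\<Sum>i<n. \<Sum>k<n. L $$ (i, k) * z k) = 0" for z
  proof -
    have "(\<Sum>i<n. \<Sum>k<n. L $$ (i, k) * z k) = (\<Sum>k<n. (\<Sum>i<n. L $$ (i, k)) * z k)"
      unfolding sum_distrib_right by (rule sum.swap)
    then show ?thesis using colsum by simp
  qed
  have sumx: "(\<Sum>i<n. x i) = (\<Sum>i<n. y i)"
  proof -
    have "(\<Sum>i<n. y i) = (\<Sum>i<n. x i - \<gamma> * (\<Sum>k<n. L $$ (i, k) * x k))" using eq by simp
    also have "\<dots> = (\<Sum>i<n. x i) - \<gamma> * (\<Sum>i<n. \<Sum>k<n. L $$ (i, k) * x k)"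
      by (simp add: sum_subtractf sum_distrib_left)
    finally show ?thesis using zero by simp
  qed
  have diag: "L $$ (i, i) \<le> 0" if "i < n" for i
  proof -
    have "0 = L $$ (i, i) + (\<Sum>k\<in>{..<n}-{i}. L $$ (k, i))"
      using colsum that sum.remove[of "{..<n}" i "\<lambda>k. L $$ (k, i)"] by simp
    moreover have "0 \<le> (\<Sum>k\<in>{..<n}-{i}. L $$ (k, i))" using off that by (intro sum_nonneg) auto
    ultimately show ?thesis by linarith
  qed
  have row: "\<bar>x i\<bar> - \<gamma> * (\<Sum>k<n. L $$ (i, k) * \<bar>x k\<bar>) \<le> y i" if i: "i < n" for i
  proof -
    have split: "(\<Sum>k<n. L $$ (i, k) * z k) = L $$ (i, i) * z i + (\<Sum>k\<in>{..<n}-{i}. L $$ (i, k) * z k)" for z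
      using i by (subst sum.remove[of _ i]) auto
    \<comment> \<open>The diagonal term, the only one whose coefficient in \<open>L\<close> can be
      negative, is moved to the left. Its total factor is nonnegative, so absolute values can be
      taken without losing the sign structure.\<close>
    have "(1 - \<gamma> * L $$ (i, i)) * x i = y i + \<gamma> * (\<Sum>k\<in>{..<n}-{i}. L $$ (i, k) * x k)"
      using eq[OF i] unfolding split by (simp add: algebra_simps)
    moreover have "0 \<le> 1 - \<gamma> * L $$ (i, i)"
      using \<gamma> diag[OF i] mult_nonneg_nonpos[of \<gamma> "L $$ (i, i)"] by simp
    ultimately have "(1 - \<gamma> * L $$ (i, i)) * \<bar>x i\<bar> = \<bar>y i + \<gamma> * (\<Sum>k\<in>{..<n}-{i}. L $$ (i, k) * x k)\<bar>"
      by (metis abs_mult abs_of_nonneg)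
    also have "\<dots> \<le> y i + \<gamma> * \<bar>\<Sum>k\<in>{..<n}-{i}. L $$ (i, k) * x k\<bar>"
      using y(1)[OF i] \<gamma> abs_triangle_ineq[of "y i" "\<gamma> * (\<Sum>k\<in>{..<n}-{i}. L $$ (i, k) * x k)"]
      by (simp add: abs_mult)
    also have "\<bar>\<Sum>k\<in>{..<n}-{i}. L $$ (i, k) * x k\<bar> \<le> (\<Sum>k\<in>{..<n}-{i}. \<bar>L $$ (i, k) * x k\<bar>)"
      by (rule sum_abs)
    also have "\<dots> = (\<Sum>k\<in>{..<n}-{i}. L $$ (i, k) * \<bar>x k\<bar>)"
      using off i by (intro sum.cong) (auto simp: abs_mult)
    finally show ?thesis unfolding split using \<gamma> by (simp add: algebra_simps)
  qed
  have "(\<Sum>i<n. \<bar>x i\<bar> - \<gamma> * (\<Sum>k<n. L $$ (i, k) * \<bar>x k\<bar>)) \<le> (\<Sum>i<n. y i)"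
    using row by (intro sum_mono) auto
  also have "(\<Sum>i<n. \<bar>x i\<bar> - \<gamma> * (\<Sum>k<n. L $$ (i, k) * \<bar>x k\<bar>))
      = (\<Sum>i<n. \<bar>x i\<bar>) - \<gamma> * (\<Sum>i<n. \<Sum>k<n. L $$ (i, k) * \<bar>x k\<bar>)"
    by (simp add: sum_subtractf sum_distrib_left)
  finally have "(\<Sum>i<n. \<bar>x i\<bar> - x i) \<le> 0" using zero sumx by (simp add: sum_subtractf)
  moreover have "0 \<le> (\<Sum>i<n. \<bar>x i\<bar> - x i)" by (intro sum_nonneg) auto
  ultimately have "(\<Sum>i<n. \<bar>x i\<bar> - x i) = 0" by linarith
  then have nonneg: "0 \<le> x i" if "i < n" for i
    using that abs_ge_zero[of "x i"] by (subst (asm) sum_nonneg_eq_0_iff) (auto simp del: abs_ge_zero)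
  define Z where "Z = {i. i < n \<and> x i = 0}"
  have "Z = {}"
  proof (rule ccontr)
    assume "Z \<noteq> {}"
    moreover have "Z \<noteq> {..<n}"
    proof
      assume "Z = {..<n}"
      then have "(\<Sum>i<n. x i) = 0" by (intro sum.neutral) (auto simp: Z_def)
      with sumx y(2) show False by simp
    qed
    moreover have "L $$ (i, j) = 0" if i: "i \<in> Z" and j: "j < n" "j \<notin> Z" for i j
    proof -
      \<comment> \<open>The diagonal term vanishes because \<open>x i = 0\<close>; the others are
        products of nonnegative numbers. Row i of the equation bounds their sum above by 0, so each
        is 0, and \<open>x j > 0\<close> forces the entry of \<open>L\<close> to vanish.\<close>
      have terms: "0 \<le> L $$ (i, k) * x k" if "k \<in> {..<n}" for k
        using i that off[of i k] nonneg[of k] by (cases "k = i") (auto simp: Z_def)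
      have "\<gamma> * (\<Sum>k<n. L $$ (i, k) * x k) \<le> 0"
        using eq[of i] y(1)[of i] i by (simp add: Z_def)
      then have "(\<Sum>k<n. L $$ (i, k) * x k) \<le> 0" using \<gamma> by (simp add: mult_le_0_iff)
      then have "(\<Sum>k<n. L $$ (i, k) * x k) = 0"
        using sum_nonneg[of "{..<n}" "\<lambda>k. L $$ (i, k) * x k"] terms by force
      then have "L $$ (i, j) * x j = 0"
        using terms j by (subst (asm) sum_nonneg_eq_0_iff) auto
      then show ?thesis using j by (simp add: Z_def)
    qed
    moreover have "Z \<subseteq> {..<n}" by (auto simp: Z_def)
    ultimately have "reducible_mat L" using reducible_matI[OF L] by blast
    with irred show False by (simp add: irreducible_mat_def)
  qed
  then show ?thesis using nonneg[OF i] i by (force simp: Z_def)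
qed

text \<open>Column j of the inverse solves the linear system whose right-hand side is the j-th unit
  vector, which is nonnegative with sum 1.\<close>

lemma metzler_resolvent_pos:
  assumes L: "L \<in> carrier_mat n n" and irred: "irreducible_mat L"
    and colsum: "\<forall>j<n. (\<Sum>i<n. L $$ (i, j)) = 0" and metzler: "metzler_mat L"
    and \<gamma>: "0 < \<gamma>" and inv: "invertible_mat (1\<^sub>m n - \<gamma> \<cdot>\<^sub>m L)"
  shows "pos_mat (inv_mat (1\<^sub>m n - \<gamma> \<cdot>\<^sub>m L))"
proof -
  let ?M = "1\<^sub>m n - \<gamma> \<cdot>\<^sub>m L"
  let ?N = "inv_mat ?M"
  have M: "?M \<in> carrier_mat n n" using L by (simp add: minus_carrier_mat)
  have MN: "?M * ?N = 1\<^sub>m n" and NM: "?N * ?M = 1\<^sub>m (dim_row ?N)"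
    using inv_mat[OF inv] M unfolding inverts_mat_def by auto
  have N: "?N \<in> carrier_mat n n"
    using arg_cong[OF MN, of dim_col] arg_cong[OF NM, of dim_col] M L by auto
  have "0 < ?N $$ (i, j)" if i: "i < n" and j: "j < n" for i j
  proof (rule metzler_resolvent_vector_pos[OF L irred colsum metzler \<gamma>,
        of "\<lambda>i. if i = j then 1 else 0" "\<lambda>i. ?N $$ (i, j)"])
    show "?N $$ (i, j) - \<gamma> * (\<Sum>k<n. L $$ (i, k) * ?N $$ (k, j)) = (if i = j then 1 else 0)"
      if i: "i < n" for i
    proof -
      have "(\<Sum>k<n. ?M $$ (i, k) * ?N $$ (k, j))
          = (\<Sum>k<n. (if k = i then ?N $$ (k, j) else 0) - \<gamma> * (L $$ (i, k) * ?N $$ (k, j)))"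
        using L i by (intro sum.cong) (auto simp: algebra_simps)
      also have "\<dots> = ?N $$ (i, j) - \<gamma> * (\<Sum>k<n. L $$ (i, k) * ?N $$ (k, j))"
        using i by (simp add: sum_subtractf sum_distrib_left)
      finally show ?thesis
        using mult_mat_index_sum[OF M N i j] MN i j by simp
    qed
  qed (use i j in auto)
  then show ?thesis using N by (auto simp: pos_mat_def)
qed

theorem theorem1:
  fixes L :: "real mat" and n :: nat
  assumes L: "L \<in> carrier_mat n n"
    and irred: "irreducible_mat L"
    and colsum: "\<forall>j<n. (\<Sum>i<n. L $$ (i, j)) = 0"
    and abscissa: "spectral_abscissa L = 0"
    and simple: "simple_eigenvalue L 0"
    and evpos: "eventually_exp_positive L"
  shows "(\<exists>\<gamma>\<^sub>0\<ge>0. \<forall>\<gamma>. \<gamma> \<ge> \<gamma>\<^sub>0 \<and> \<gamma> > 0 \<longrightarrow>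
            invertible_mat (1\<^sub>m n - \<gamma> \<cdot>\<^sub>m L) \<and> pos_mat (inv_mat (1\<^sub>m n - \<gamma> \<cdot>\<^sub>m L)))
    \<and> ((\<exists>i<n. \<exists>j<n. i \<noteq> j \<and> L $$ (i, j) < 0) \<longrightarrow>
          (\<exists>\<gamma>\<^sub>1>0. \<forall>\<gamma>. 0 < \<gamma> \<and> \<gamma> < \<gamma>\<^sub>1 \<longrightarrow>
              invertible_mat (1\<^sub>m n - \<gamma> \<cdot>\<^sub>m L) \<and>
              (\<exists>i<n. \<exists>j<n. inv_mat (1\<^sub>m n - \<gamma> \<cdot>\<^sub>m L) $$ (i, j) < 0))
        \<and> (\<forall>\<gamma>\<^sub>0\<ge>0.
              (\<forall>\<gamma>. \<gamma> \<ge> \<gamma>\<^sub>0 \<and> \<gamma> > 0 \<longrightarrow>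
                 invertible_mat (1\<^sub>m n - \<gamma> \<cdot>\<^sub>m L) \<and> pos_mat (inv_mat (1\<^sub>m n - \<gamma> \<cdot>\<^sub>m L)))
              \<longrightarrow> \<gamma>\<^sub>0 > 0))
    \<and> (metzler_mat L \<longrightarrow>
          (\<forall>\<gamma>>0. invertible_mat (1\<^sub>m n - \<gamma> \<cdot>\<^sub>m L) \<and> pos_mat (inv_mat (1\<^sub>m n - \<gamma> \<cdot>\<^sub>m L))))"
proof -
  obtain q where q: "char_poly L = [:0, 1:] * q" and qpos: "\<And>s. 0 \<le> s \<Longrightarrow> 0 < poly q s"
    using char_poly_simple_zero[OF L abscissa simple] by blast
  \<comment> \<open>At s = 1 / \<gamma> the characteristic polynomial is s q(s), a product of
    positive numbers.\<close>
  have inv: "invertible_mat (1\<^sub>m n - \<gamma> \<cdot>\<^sub>m L)" if "0 < \<gamma>" for \<gamma>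
    by (rule resolvent_adj_char_poly_matrix(1)[OF L])
      (use that qpos[of "1 / \<gamma>"] in \<open>auto simp: q\<close>)
  have large: "\<exists>\<gamma>\<^sub>0\<ge>0. \<forall>\<gamma>. \<gamma> \<ge> \<gamma>\<^sub>0 \<and> \<gamma> > 0 \<longrightarrow>
      invertible_mat (1\<^sub>m n - \<gamma> \<cdot>\<^sub>m L) \<and> pos_mat (inv_mat (1\<^sub>m n - \<gamma> \<cdot>\<^sub>m L))"
    using resolvent_pos_large[OF L colsum evpos q qpos] inv less_imp_le by meson
  have small: "\<exists>\<gamma>\<^sub>1>0. \<forall>\<gamma>. 0 < \<gamma> \<and> \<gamma> < \<gamma>\<^sub>1 \<longrightarrow>
      invertible_mat (1\<^sub>m n - \<gamma> \<cdot>\<^sub>m L) \<and>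
      (\<exists>i<n. \<exists>j<n. inv_mat (1\<^sub>m n - \<gamma> \<cdot>\<^sub>m L) $$ (i, j) < 0)"
    if "\<exists>i<n. \<exists>j<n. i \<noteq> j \<and> L $$ (i, j) < 0"
    using that resolvent_neg_small[OF L] by meson
  have threshold: "0 < \<gamma>\<^sub>0"
    if neg: "\<exists>i<n. \<exists>j<n. i \<noteq> j \<and> L $$ (i, j) < 0" and "0 \<le> \<gamma>\<^sub>0"
      and pos: "\<forall>\<gamma>. \<gamma> \<ge> \<gamma>\<^sub>0 \<and> \<gamma> > 0 \<longrightarrow>
        invertible_mat (1\<^sub>m n - \<gamma> \<cdot>\<^sub>m L) \<and> pos_mat (inv_mat (1\<^sub>m n - \<gamma> \<cdot>\<^sub>m L))" for \<gamma>\<^sub>0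
  proof (rule ccontr)
    assume "\<not> 0 < \<gamma>\<^sub>0"
    obtain i j where ij: "i < n" "j < n" "i \<noteq> j" "L $$ (i, j) < 0" using neg by blast
    from resolvent_neg_small[OF L ij] obtain \<gamma>\<^sub>1 where "0 < \<gamma>\<^sub>1"
      and "\<And>\<gamma>. 0 < \<gamma> \<Longrightarrow> \<gamma> < \<gamma>\<^sub>1 \<Longrightarrow> inv_mat (1\<^sub>m n - \<gamma> \<cdot>\<^sub>m L) $$ (i, j) < 0" by blast
    \<comment> \<open>With threshold 0 positivity would hold at every \<gamma> > 0, in particular at
      this point inside the range of the negative entry.\<close>
    then have "inv_mat (1\<^sub>m n - (\<gamma>\<^sub>1 / 2) \<cdot>\<^sub>m L) $$ (i, j) < 0" and "0 < \<gamma>\<^sub>1 / 2" by auto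
    moreover from this pos \<open>\<not> 0 < \<gamma>\<^sub>0\<close> have "pos_mat (inv_mat (1\<^sub>m n - (\<gamma>\<^sub>1 / 2) \<cdot>\<^sub>m L))" by auto
    \<comment> \<open>\<open>pos_mat\<close> ranges over the dimensions of the inverse itself, so
      these must be known before it speaks about the entry (i, j).\<close>
    moreover have "inv_mat (1\<^sub>m n - (\<gamma>\<^sub>1 / 2) \<cdot>\<^sub>m L) \<in> carrier_mat n n"
      using resolvent_adj_char_poly_matrix(2)[OF L, of "\<gamma>\<^sub>1 / 2"] qpos[of "1 / (\<gamma>\<^sub>1 / 2)"] \<open>0 < \<gamma>\<^sub>1 / 2\<close>
      by (auto simp: q)
    ultimately show False using ij by (force simp: pos_mat_def)
  qed
  have metzler: "\<forall>\<gamma>>0. invertible_mat (1\<^sub>m n - \<gamma> \<cdot>\<^sub>m L) \<and> pos_mat (inv_mat (1\<^sub>m n - \<gamma> \<cdot>\<^sub>m L))"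
    if "metzler_mat L"
    using metzler_resolvent_pos[OF L irred colsum that] inv by blast
  show ?thesis using large small threshold metzler by blast
qed

end
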